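(* Let $\eta=\lambda/(k\mu)$ and $\tau=k\mu t$. For $t\ge 0$, the probability that there are no customers in the Erlang queue with multiple arrivals at time $t$ is $$p_0(t)=\frac1\tau\sum_{h=1}^{\infty}h\sum_{n=0}^{\infty}\eta^n\sum_{\substack{m_1+\dots+m_l=n\\ m_j\in\mathbb{N}_0}}\Big(\prod_{i=1}^{l}\frac{c_i^{m_i}}{m_i!}\Big)\frac{\tau^{\,h+n+k\sum_{j=1}^{l}jm_j}}{\big(h+k\sum_{j=1}^{l}jm_j\big)!}\,e^{-(1+\eta)\tau}.$$
   Context: Let $k,l\ge 1$ be integers, $\mu>0$, $\lambda_1,\dots,\lambda_l>0$, $\lambda=\lambda_1+\dots+\lambda_l$ and $c_m=\lambda_m/\lambda$ for $1\le m\le l$. $\mathbb{N}_0=\{0,1,2,\dots\}$. The Erlang queue with multiple arrivals is the continuous-time Markov process $\mathcal{Q}(t)=(\mathcal{N}(t),\mathcal{S}(t))$, $t\ge 0$, on the state space $\mathcal{H}_0=\mathcal{H}\cup\{(0,0)\}$, $\mathcal{H}=\{(n,s)\in\mathbb{N}\times\mathbb{N}: n\ge 1,\ 1\le s\le k\}$, with $\mathcal{Q}(0)=(0,0)$. Here $\mathcal{N}(t)$ is the number of customers in a single-channel system and $\mathcal{S}(t)$ is the phase of the customer in service (each service starts in phase $k$, and the phases are counted down to $1$), with $\mathcal{S}(t)=0$ if $\mathcal{N}(t)=0$. Its nonzero transition rates (an event of rate $q$ has probability $qh+o(h)$ in an interval of length $h$) are, for $1\le m\le l$: (arrivals) $(0,0)\to(m,k)$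 at rate $\lambda_m=\lambda c_m$, and $(n,s)\to(n+m,s)$ at rate $\lambda_m=\lambda c_m$ for $(n,s)\in\mathcal{H}$; (service, each phase being exponential with mean $1/(k\mu)$) at rate $k\mu$: $(n,s)\to(n,s-1)$ for $n\ge1$, $2\le s\le k$; $(n,1)\to(n-1,k)$ for $n\ge 2$; and $(1,1)\to(0,0)$. $p_0(t)=\Pr(\mathcal{Q}(t)=(0,0)\mid\mathcal{Q}(0)=(0,0))$. At $t=0$ the factor $1/\tau$ is understood as absorbed into the powers of $\tau$ (whose exponents are at least $1$), with $0^0=1$. *)

theory Defs
  imports "HOL-Probability.Probability" "HOL-Library.Landau_Symbols"
begin

section \<open>Continuous-time Markov chains with prescribed transition rates\<close>

definition transition_function :: "'s set \<Rightarrow> (real \<Rightarrow> 's \<Rightarrow> 's \<Rightarrow> real) \<Rightarrow> bool" where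
  "transition_function S P \<longleftrightarrow>
     (\<forall>t\<ge>0. \<forall>x\<in>S. (\<forall>y\<in>S. 0 \<le> P t x y) \<and> ((\<lambda>y. P t x y) has_sum 1) S) \<and>
     (\<forall>x\<in>S. \<forall>y\<in>S. P 0 x y = (if x = y then 1 else 0)) \<and>
     (\<forall>s\<ge>0. \<forall>t\<ge>0. \<forall>x\<in>S. \<forall>y\<in>S. ((\<lambda>z. P s x z * P t z y) has_sum P (s + t) x y) S)"

text \<open>The values of \<open>q\<close> on the diagonal are irrelevant; the last clause says that the process
  stays put during an interval of length \<open>h\<close> up to the total rate of leaving \<open>x\<close>.\<close>

definition has_transition_rates ::
    "'s set \<Rightarrow> (real \<Rightarrow> 's \<Rightarrow> 's \<Rightarrow> real) \<Rightarrow> ('s \<Rightarrow> 's \<Rightarrow> real) \<Rightarrow> bool" where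
  "has_transition_rates S P q \<longleftrightarrow>
     (\<forall>x\<in>S. \<forall>y\<in>S. x \<noteq> y \<longrightarrow> (\<lambda>h. P h x y - q x y * h) \<in> o[at_right 0](\<lambda>h. h)) \<and>
     (\<forall>x\<in>S. (\<lambda>h. 1 - P h x x - (\<Sum>\<^sub>\<infinity>y\<in>S - {x}. q x y) * h) \<in> o[at_right 0](\<lambda>h. h))"

text \<open>Time-homogeneous Markov property: the conditional law of \<open>X (t + h)\<close> given \<open>X t = x\<close> and
  the values \<open>\<xi>\<close> of the process at finitely many earlier times \<open>T\<close> is \<open>P h x\<close>.\<close>

definition markov_process ::
    "'a measure \<Rightarrow> 's set \<Rightarrow> (real \<Rightarrow> 's \<Rightarrow> 's \<Rightarrow> real) \<Rightarrow> (real \<Rightarrow> 'a \<Rightarrow> 's) \<Rightarrow> bool" where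
  "markov_process M S P X \<longleftrightarrow>
     prob_space M \<and> transition_function S P \<and>
     (\<forall>t\<ge>0. X t \<in> measurable M (count_space UNIV) \<and> (\<forall>\<omega>\<in>space M. X t \<omega> \<in> S)) \<and>
     (\<forall>t\<ge>0. \<forall>h\<ge>0. \<forall>T \<xi>. \<forall>x\<in>S. \<forall>y\<in>S. finite T \<longrightarrow> T \<subseteq> {0..t} \<longrightarrow>
        \<P>(\<omega> in M. (\<forall>s\<in>T. X s \<omega> = \<xi> s) \<and> X t \<omega> = x) > 0 \<longrightarrow>
        \<P>(\<omega> in M. X (t + h) \<omega> = y \<bar> (\<forall>s\<in>T. X s \<omega> = \<xi> s) \<and> X t \<omega> = x) = P h x y)"

definition markov_process_with_rates ::
    "'a measure \<Rightarrow> 's set \<Rightarrow> ('s \<Rightarrow> 's \<Rightarrow> real) \<Rightarrow> (real \<Rightarrow> 'a \<Rightarrow> 's) \<Rightarrow> bool" where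
  "markov_process_with_rates M S q X \<longleftrightarrow>
     (\<exists>P. markov_process M S P X \<and> has_transition_rates S P q)"


section \<open>The Erlang queue with multiple arrivals\<close>

definition erlang_states :: "nat \<Rightarrow> (nat \<times> nat) set" where
  "erlang_states k = insert (0, 0) {(n, s). 1 \<le> n \<and> 1 \<le> s \<and> s \<le> k}"

inductive arrival :: "nat \<Rightarrow> nat \<Rightarrow> nat \<times> nat \<Rightarrow> nat \<times> nat \<Rightarrow> bool" for k m where
  "arrival k m (0, 0) (m, k)"
| "1 \<le> n \<Longrightarrow> 1 \<le> s \<Longrightarrow> s \<le> k \<Longrightarrow> arrival k m (n, s) (n + m, s)"

inductive phase_completion :: "nat \<Rightarrow> nat \<times> nat \<Rightarrow> nat \<times> nat \<Rightarrow> bool" for k where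
  "1 \<le> n \<Longrightarrow> 2 \<le> s \<Longrightarrow> s \<le> k \<Longrightarrow> phase_completion k (n, s) (n, s - 1)"
| "2 \<le> n \<Longrightarrow> phase_completion k (n, 1) (n - 1, k)"
| "phase_completion k (1, 1) (0, 0)"

definition erlang_rate ::
    "nat \<Rightarrow> nat \<Rightarrow> real \<Rightarrow> (nat \<Rightarrow> real) \<Rightarrow> nat \<times> nat \<Rightarrow> nat \<times> nat \<Rightarrow> real" where
  "erlang_rate k l \<mu> lam x y =
     (\<Sum>m=1..l. lam m * of_bool (arrival k m x y)) + real k * \<mu> * of_bool (phase_completion k x y)"

definition erlang_queue ::
    "nat \<Rightarrow> nat \<Rightarrow> real \<Rightarrow> (nat \<Rightarrow> real) \<Rightarrow> 'a measure \<Rightarrow> (real \<Rightarrow> 'a \<Rightarrow> nat \<times> nat) \<Rightarrow> bool" where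
  "erlang_queue k l \<mu> lam M Q \<longleftrightarrow>
     markov_process_with_rates M (erlang_states k) (erlang_rate k l \<mu> lam) Q \<and>
     (AE \<omega> in M. Q 0 \<omega> = (0, 0))"

definition prob_empty :: "'a measure \<Rightarrow> (real \<Rightarrow> 'a \<Rightarrow> nat \<times> nat) \<Rightarrow> real \<Rightarrow> real" where
  "prob_empty M Q t = \<P>(\<omega> in M. Q t \<omega> = (0, 0) \<bar> Q 0 \<omega> = (0, 0))"

definition compositions :: "nat \<Rightarrow> nat \<Rightarrow> (nat \<Rightarrow> nat) set" where
  "compositions l n = {m \<in> {1..l} \<rightarrow>\<^sub>E UNIV. (\<Sum>i=1..l. m i) = n}"

text \<open>The parameter \<open>d\<close> is the number of factors \<open>\<tau>\<close> cancelled from the power of \<open>\<tau>\<close>: \<open>d = 0\<close> gives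
  the series with a factor \<open>1 / \<tau>\<close> in front, \<open>d = 1\<close> the one with that factor absorbed.
  Only \<open>h \<ge> 1\<close> is used, so the subtraction does not truncate.\<close>

definition erlang_summand ::
    "nat \<Rightarrow> nat \<Rightarrow> nat \<Rightarrow> real \<Rightarrow> (nat \<Rightarrow> real) \<Rightarrow> real \<Rightarrow> nat \<Rightarrow> nat \<Rightarrow> real" where
  "erlang_summand d k l \<eta> c \<tau> h n =
     \<eta> ^ n * (\<Sum>m\<in>compositions l n.
       (\<Prod>i=1..l. c i ^ m i / fact (m i)) *
       (\<tau> ^ (h + n + k * (\<Sum>j=1..l. j * m j) - d) / fact (h + k * (\<Sum>j=1..l. j * m j))) *
       exp (- (1 + \<eta>) * \<tau>))"

end

theory Submission
  imports Defs
begin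

text \<open>
  The number of service phases still to be completed goes up by \<open>k * m\<close> when a batch of \<open>m\<close> customers
  arrives and down by one when a phase is completed, until it reaches zero. In the time scale \<open>\<tau>\<close>,
  where phases are completed at rate one, let \<open>Y\<close> be the free walk with these jumps, started at zero.
  Since \<open>Y\<close> moves down by single steps, the ballot theorem gives the density of its first passage to \<open>-h\<close>
  at time \<open>\<tau>\<close> as \<open>h / \<tau>\<close> times the probability of \<open>Y = -h\<close>. The queue is empty when \<open>Y\<close> is at its running
  minimum, and a completed phase lowers the minimum exactly then. So the probability of being empty
  is the rate at which new minima are reached, which is the sum over \<open>h \<ge> 1\<close> of the first-passage densities;
  expanding the Poisson numbers of arrivals and completions gives the formula. Starting
  with \<open>r\<close> phases of work, the same argument gives the sum over \<open>h > r\<close>.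

  The proof verifies this answer instead of arguing with sample paths. It considers the
  probability \<open>u\<close> of being empty as a function of the starting state, multiplied by
  \<open>exp ((1 + \<eta>) * \<tau>)\<close>. By the backward equation (\<open>kolmogorov_backward\<close>, \<open>erlang_backward\<close>)
  its derivative in \<open>\<tau>\<close> is a bounded operator \<open>B\<close> applied to it (\<open>queue_step\<close>), so by Taylor's theorem it
  is the power series whose coefficients are the iterates of \<open>B\<close> on the indicator of the empty
  state, divided by factorials (\<open>erlang_empty_probability_series\<close>). The coefficients of the
  claimed formula obey the same recursion (\<open>empty_coeff_Suc\<close>), which follows from the backward
  equation for the first-passage densities. At the level of coefficients that equation is an
  identity between integers for each vector of batch counts (\<open>passage_coeff_Suc\<close>). Everything is
  nonnegative, so the power series in \<open>\<tau>\<close> may be rearranged into the stated double series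
  (\<open>empty_series_by_passage_level\<close>).
\<close>

section \<open>Coefficients of the first-passage densities\<close>

abbreviation arrival_vectors :: "nat \<Rightarrow> (nat \<Rightarrow> nat) set" where
  "arrival_vectors l \<equiv> {1..l} \<rightarrow>\<^sub>E UNIV"

abbreviation arrivals :: "nat \<Rightarrow> (nat \<Rightarrow> nat) \<Rightarrow> nat" where
  "arrivals l m \<equiv> \<Sum>i=1..l. m i"

abbreviation customers :: "nat \<Rightarrow> (nat \<Rightarrow> nat) \<Rightarrow> nat" where
  "customers l m \<equiv> \<Sum>j=1..l. j * m j"

abbreviation arrival_weight :: "nat \<Rightarrow> (nat \<Rightarrow> real) \<Rightarrow> (nat \<Rightarrow> nat) \<Rightarrow> real" where
  "arrival_weight l a m \<equiv> \<Prod>i=1..l. a i ^ m i / fact (m i)"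

text \<open>
  For the free walk with \<open>m i\<close> batches of size \<open>i\<close>, being at level \<open>-h\<close> means that
  \<open>h + k * customers l m\<close> phases have been completed. Writing the density of first passage
  to \<open>-h\<close> as \<open>exp (- (1 + \<eta>) * \<tau>)\<close> times a power series in \<open>\<tau>\<close>, the vector \<open>m\<close> contributes
  to the power whose exponent is the total number of events minus one (one factor \<open>\<tau>\<close> is
  cancelled by the ballot factor \<open>h / \<tau>\<close>). Hence \<open>passages\<close> collects the vectors that contribute to
  \<open>\<tau> ^ N\<close>, and \<open>passage_coeff\<close> is the coefficient. Stating the condition with \<open>Suc N\<close> instead of a
  difference keeps the case \<open>h = 0\<close> harmless.
\<close>

definition passages :: "nat \<Rightarrow> nat \<Rightarrow> nat \<Rightarrow> nat \<Rightarrow> (nat \<Rightarrow> nat) set" where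
  "passages k l h N = {m \<in> arrival_vectors l. h + arrivals l m + k * customers l m = Suc N}"

definition passage_coeff :: "nat \<Rightarrow> nat \<Rightarrow> (nat \<Rightarrow> real) \<Rightarrow> nat \<Rightarrow> nat \<Rightarrow> real" where
  "passage_coeff k l a h N =
     (\<Sum>m\<in>passages k l h N. h * arrival_weight l a m / fact (h + k * customers l m))"

lemma finite_arrivals_le: "finite {m \<in> arrival_vectors l. arrivals l m \<le> N}"
proof (rule finite_subset)
  show "{m \<in> arrival_vectors l. arrivals l m \<le> N} \<subseteq> {1..l} \<rightarrow>\<^sub>E {..N}"
  proof
    fix m :: "nat \<Rightarrow> nat" assume "m \<in> {m \<in> arrival_vectors l. arrivals l m \<le> N}"
    then have m: "m \<in> arrival_vectors l" "arrivals l m \<le> N" by auto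
    have "m i \<le> N" if "i \<in> {1..l}" for i
      using member_le_sum[of i "{1..l}" m] that m(2) by simp
    then show "m \<in> {1..l} \<rightarrow>\<^sub>E {..N}"
      using m(1) by (auto simp: PiE_iff)
  qed
qed (simp add: finite_PiE)

lemma finite_compositions: "finite (compositions l n)"
  by (rule finite_subset[OF _ finite_arrivals_le[of l n]]) (auto simp: compositions_def)

lemma finite_passages: "finite (passages k l h N)"
  by (rule finite_subset[OF _ finite_arrivals_le[of l "Suc N"]]) (auto simp: passages_def)

lemma passage_coeff_0 [simp]: "passage_coeff k l a 0 N = 0"
  by (simp add: passage_coeff_def)

lemma passage_coeff_eq_0:
  assumes "h > Suc N"
  shows "passage_coeff k l a h N = 0"
proof -
  have "passages k l h N = {}"
    using assms by (auto simp: passages_def)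
  then show ?thesis by (simp add: passage_coeff_def)
qed

lemma passage_coeff_1_0: "passage_coeff k l a (Suc 0) 0 = 1"
proof -
  have "passages k l (Suc 0) 0 = {\<lambda>i\<in>{1..l}. 0}"
    by (auto simp: passages_def fun_eq_iff PiE_iff extensional_def)
  then show ?thesis by (simp add: passage_coeff_def)
qed

lemma sum_upd_add:
  fixes m f :: "nat \<Rightarrow> nat"
  assumes "j \<in> A" "finite A"
  shows "(\<Sum>i\<in>A. f i * (m(j := Suc (m j))) i) = f j + (\<Sum>i\<in>A. f i * m i)"
  using assms by (simp add: sum.remove[of A j])

text \<open>
  This is the identity \<open>n * (x ^ n / n!) = x * (x ^ (n - 1) / (n - 1)!)\<close> for the factor \<open>j\<close>.
\<close>

lemma arrival_weight_upd:
  assumes "j \<in> {1..l}"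
  shows "real (Suc (m j)) * arrival_weight l a (m(j := Suc (m j))) = a j * arrival_weight l a m"
proof -
  have "(\<Prod>i\<in>{1..l}-{j}. a i ^ (m(j := Suc (m j))) i / fact ((m(j := Suc (m j))) i)) =
        (\<Prod>i\<in>{1..l}-{j}. a i ^ m i / fact (m i))"
    by (rule prod.cong) auto
  moreover have "real (Suc (m j)) * (a j ^ Suc (m j) / fact (Suc (m j))) = a j * (a j ^ m j / fact (m j))"
    by (simp add: field_simps del: of_nat_Suc)
  ultimately show ?thesis
    unfolding prod.remove[OF finite_atLeastAtMost assms] by (simp only: mult.assoc[symmetric] fun_upd_same)
qed

text \<open>
  Adding one batch of size \<open>j\<close> maps the vectors for level \<open>h + k * j\<close> and \<open>N\<close> bijectively to those for
  level \<open>h\<close> and \<open>Suc N\<close> with \<open>m j \<noteq> 0\<close>, and leaves the number \<open>h + k * customers l m\<close> of completed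
  phases unchanged. The vectors with \<open>m j = 0\<close> carry the factor \<open>m j\<close> and may be included.
\<close>

lemma passage_coeff_add_arrival:
  assumes j: "j \<in> {1..l}"
  shows "a j * passage_coeff k l a (h + k * j) N =
    (\<Sum>m\<in>passages k l h (Suc N).
       m j * (h + k * j) * arrival_weight l a m / fact (h + k * customers l m))"
proof -
  let ?up = "\<lambda>m::nat \<Rightarrow> nat. m(j := Suc (m j))"
  have "(\<Sum>m\<in>passages k l h (Suc N).
          m j * (h + k * j) * arrival_weight l a m / fact (h + k * customers l m)) =
        (\<Sum>m\<in>{m \<in> passages k l h (Suc N). m j \<noteq> 0}.
          m j * (h + k * j) * arrival_weight l a m / fact (h + k * customers l m))"
    by (rule sum.mono_neutral_right) (auto simp: finite_passages)
  also have "\<dots> = (\<Sum>m\<in>passages k l (h + k * j) N.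
          a j * ((h + k * j) * arrival_weight l a m / fact (h + k * j + k * customers l m)))"
  proof (rule sum.reindex_bij_witness[of _ ?up "\<lambda>m. m(j := m j - 1)"])
    fix m assume m: "m \<in> {m \<in> passages k l h (Suc N). m j \<noteq> 0}"
    define m' where "m' = m(j := m j - 1)"
    have up: "?up m' = m" using m by (auto simp: m'_def fun_eq_iff)
    have s: "arrivals l m = Suc (arrivals l m')"
      using sum_upd_add[of j "{1..l}" "\<lambda>_. 1" m'] j unfolding up by simp
    have w: "customers l m = j + customers l m'"
      using sum_upd_add[of j "{1..l}" "\<lambda>i. i" m'] j unfolding up by simp
    show "?up (m(j := m j - 1)) = m" using m by auto
    have "m' \<in> arrival_vectors l" using m j by (auto simp: m'_def passages_def PiE_iff extensional_def)
    moreover have "h + k * j + arrivals l m' + k * customers l m' = Suc N"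
      using m s w by (simp add: passages_def add_mult_distrib2)
    ultimately show "m(j := m j - 1) \<in> passages k l (h + k * j) N"
      unfolding m'_def[symmetric] passages_def by simp
    have "real (m j) * arrival_weight l a m = a j * arrival_weight l a m'"
    proof -
      have "Suc (m' j) = m j" using m by (simp add: m'_def)
      then show ?thesis using arrival_weight_upd[OF j, of m' a] unfolding up by (simp only:)
    qed
    then have "real (m j * (h + k * j)) * arrival_weight l a m
        = a j * (real (h + k * j) * arrival_weight l a m')" by (simp only: of_nat_mult mult.assoc) (metis mult.left_commute)
    then show "a j * (real (h + k * j) * arrival_weight l a (m(j := m j - 1)) /
          fact (h + k * j + k * customers l (m(j := m j - 1)))) =
        real (m j * (h + k * j)) * arrival_weight l a m / fact (h + k * customers l m)"
      unfolding m'_def[symmetric] w add_mult_distrib2 add.assoc by (simp only: times_divide_eq_right)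
  next
    fix m assume m: "m \<in> passages k l (h + k * j) N"
    have s: "arrivals l (?up m) = Suc (arrivals l m)"
      using sum_upd_add[of j "{1..l}" "\<lambda>_. 1" m] j by simp
    have w: "customers l (?up m) = j + customers l m"
      using sum_upd_add[of j "{1..l}" "\<lambda>i. i" m] j by simp
    have "?up m \<in> arrival_vectors l" using m j by (auto simp: passages_def PiE_iff extensional_def)
    moreover have "h + arrivals l (?up m) + k * customers l (?up m) = Suc (Suc N)"
      using m unfolding s w by (simp add: passages_def add_mult_distrib2)
    ultimately show "?up m \<in> {m \<in> passages k l h (Suc N). m j \<noteq> 0}"
      unfolding passages_def by simp
  qed auto
  finally show ?thesis
    by (simp add: passage_coeff_def sum_distrib_left)
qed

text \<open>
  The first-passage densities solve the backward equation of the free walk: conditioning on the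
  first event, level \<open>-h\<close> becomes \<open>-(h - 1)\<close> after a completed phase and \<open>-(h + k * j)\<close> after a batch
  of size \<open>j\<close>. On coefficients, both sides are sums over the same vectors with the same weights
  divided by the factorial of \<open>h + k * w\<close>, and it remains to compare the integer factors
  \<open>h * (N + 1)\<close> and \<open>(h - 1) * (h + k * w) + (h * s + k * w)\<close>, where \<open>s\<close> is the number of batches and
  \<open>w\<close> the number of customers; they agree because \<open>h + s + k * w = N + 2\<close>. This is where the
  ballot factor \<open>h\<close> is used.
\<close>

lemma passage_coeff_Suc:
  assumes h: "h \<ge> 1"
  shows "real (Suc N) * passage_coeff k l a h (Suc N) =
    passage_coeff k l a (h - 1) N + (\<Sum>j=1..l. a j * passage_coeff k l a (h + k * j) N)"
proof -
  let ?W = "arrival_weight l a" and ?w = "customers l"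
  have 1: "passage_coeff k l a (h - 1) N =
      (\<Sum>m\<in>passages k l h (Suc N). (h - 1) * (h + k * ?w m) * ?W m / fact (h + k * ?w m))"
    unfolding passage_coeff_def
  proof (rule sum.cong)
    show "passages k l (h - 1) N = passages k l h (Suc N)"
      using h by (auto simp: passages_def)
    fix m
    obtain g where g: "h = Suc g" using h by (cases h) auto
    have frac: "b * W / F = b * x * W / (x * F)" if "x \<noteq> 0" for b x W F :: real
      using that by simp
    have "fact (h + k * ?w m) = real (Suc (g + k * ?w m)) * fact (h - 1 + k * ?w m)"
      by (simp add: g)
    moreover have "h + k * ?w m = Suc (g + k * ?w m)"
      by (simp add: g)
    ultimately show "real (h - 1) * ?W m / fact (h - 1 + k * ?w m) =
       real ((h - 1) * (h + k * ?w m)) * ?W m / fact (h + k * ?w m)"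
      using frac[of "real (Suc (g + k * ?w m))" "real (h - 1)" "?W m" "fact (h - 1 + k * ?w m)"]
      by (simp only: of_nat_mult)
  qed
  have 2: "(\<Sum>j=1..l. a j * passage_coeff k l a (h + k * j) N) =
      (\<Sum>m\<in>passages k l h (Suc N).
         (h * arrivals l m + k * ?w m) * ?W m / fact (h + k * ?w m))"
  proof -
    have "(\<Sum>j=1..l. a j * passage_coeff k l a (h + k * j) N) =
      (\<Sum>j=1..l. \<Sum>m\<in>passages k l h (Suc N). m j * (h + k * j) * ?W m / fact (h + k * ?w m))"
      by (intro sum.cong refl passage_coeff_add_arrival)
    also have "\<dots> = (\<Sum>m\<in>passages k l h (Suc N). \<Sum>j=1..l. m j * (h + k * j) * ?W m / fact (h + k * ?w m))"
      by (rule sum.swap)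
    also have "\<dots> = (\<Sum>m\<in>passages k l h (Suc N).
         (h * arrivals l m + k * ?w m) * ?W m / fact (h + k * ?w m))"
    proof (rule sum.cong)
      fix m
      have "h * arrivals l m + k * ?w m = (\<Sum>j=1..l. m j * (h + k * j))"
        by (simp add: sum_distrib_left sum.distrib[symmetric] algebra_simps)
      then show "(\<Sum>j=1..l. m j * (h + k * j) * ?W m / fact (h + k * ?w m)) =
         (h * arrivals l m + k * ?w m) * ?W m / fact (h + k * ?w m)"
        by (simp only: of_nat_sum sum_divide_distrib sum_distrib_right)
    qed simp
    finally show ?thesis .
  qed
  have 3: "real (Suc N) * passage_coeff k l a h (Suc N) =
      (\<Sum>m\<in>passages k l h (Suc N). Suc N * (h * ?W m / fact (h + k * ?w m)))"
    unfolding passage_coeff_def by (rule sum_distrib_left)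
  show ?thesis
    unfolding 1 2 3 sum.distrib[symmetric]
  proof (rule sum.cong)
    fix m assume m: "m \<in> passages k l h (Suc N)"
    obtain g where g: "h = Suc g" using h by (cases h) auto
    have "g + arrivals l m + k * ?w m = Suc N"
      using m by (simp add: passages_def g)
    then have "Suc N * h = (h - 1) * (h + k * ?w m) + (h * arrivals l m + k * ?w m)"
      by (simp add: g algebra_simps flip: \<open>_ = Suc N\<close>)
    then have "real (Suc N) * real h =
        real ((h - 1) * (h + k * ?w m)) + real (h * arrivals l m + k * ?w m)"
      by (metis of_nat_add of_nat_mult)
    moreover have "s * (b * W / D) = u * W / D + v * W / D" if "s * b = u + v"
      for s b u v W D :: real
      using that by (simp add: add_divide_distrib[symmetric] distrib_right[symmetric] mult.assoc[symmetric])
    ultimately show "real (Suc N) * (real h * ?W m / fact (h + k * ?w m)) =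
        real ((h - 1) * (h + k * ?w m)) * ?W m / fact (h + k * ?w m) +
        real (h * arrivals l m + k * ?w m) * ?W m / fact (h + k * ?w m)"
      by blast
  qed simp
qed

text \<open>
  The coefficient of \<open>\<tau> ^ N\<close> in \<open>exp ((1 + \<eta>) * \<tau>)\<close> times the probability that the queue is empty when it
  starts with \<open>r\<close> phases of work. The sum over all levels \<open>h > r\<close> stops at \<open>Suc N\<close> since later
  coefficients vanish.
\<close>

definition empty_coeff :: "nat \<Rightarrow> nat \<Rightarrow> (nat \<Rightarrow> real) \<Rightarrow> nat \<Rightarrow> nat \<Rightarrow> real" where
  "empty_coeff k l a N r = (\<Sum>h\<in>{r<..Suc N}. passage_coeff k l a h N)"

text \<open>
  A variable upper bound is needed to compare sums whose ranges are shifted by \<open>k * j\<close>.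
\<close>

lemma empty_coeff_upto:
  assumes "R \<ge> Suc N"
  shows "empty_coeff k l a N r = (\<Sum>h\<in>{r<..R}. passage_coeff k l a h N)"
  unfolding empty_coeff_def
  by (rule sum.mono_neutral_left) (use assms in \<open>auto simp: passage_coeff_eq_0\<close>)

lemma empty_coeff_0: "empty_coeff k l a 0 r = of_bool (r = 0)"
proof (cases "r = 0")
  case True
  have "{0<..Suc 0} = {Suc 0}" by auto
  with True show ?thesis by (simp add: empty_coeff_def passage_coeff_1_0)
qed (simp add: empty_coeff_def)

text \<open>
  Summing the recursion over \<open>h > r\<close> shifts the range of summation. For \<open>r = 0\<close> the shift brings in
  level \<open>0\<close>, whose coefficient vanishes; so the truncated \<open>r - 1\<close> is exactly right and expresses
  that a phase completion in the empty system has no effect.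
\<close>

lemma empty_coeff_Suc:
  "real (Suc N) * empty_coeff k l a (Suc N) r =
     empty_coeff k l a N (r - 1) + (\<Sum>j=1..l. a j * empty_coeff k l a N (r + k * j))"
proof -
  let ?b = "passage_coeff k l a" and ?R = "Suc (Suc N)"
  have "real (Suc N) * empty_coeff k l a (Suc N) r = (\<Sum>h\<in>{r<..?R}. real (Suc N) * ?b h (Suc N))"
    by (simp add: empty_coeff_def sum_distrib_left)
  also have "\<dots> = (\<Sum>h\<in>{r<..?R}. ?b (h - 1) N) + (\<Sum>h\<in>{r<..?R}. \<Sum>j=1..l. a j * ?b (h + k * j) N)"
    unfolding sum.distrib[symmetric] by (intro sum.cong refl passage_coeff_Suc) auto
  also have "(\<Sum>h\<in>{r<..?R}. ?b (h - 1) N) = empty_coeff k l a N (r - 1)"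
  proof (cases r)
    case 0
    have "(\<Sum>h\<in>{0<..?R}. ?b (h - 1) N) = (\<Sum>h\<in>{..Suc N}. ?b h N)"
      by (rule sum.reindex_bij_witness[of _ Suc "\<lambda>h. h - 1"]) auto
    also have "\<dots> = (\<Sum>h\<in>{0<..Suc N}. ?b h N)"
      by (rule sum.mono_neutral_right) auto
    finally show ?thesis by (simp add: 0 empty_coeff_def)
  next
    case (Suc r')
    have "(\<Sum>h\<in>{r<..?R}. ?b (h - 1) N) = (\<Sum>h\<in>{r'<..Suc N}. ?b h N)"
      by (rule sum.reindex_bij_witness[of _ Suc "\<lambda>h. h - 1"]) (auto simp: Suc)
    then show ?thesis by (simp add: Suc empty_coeff_def)
  qed
  also have "(\<Sum>h\<in>{r<..?R}. \<Sum>j=1..l. a j * ?b (h + k * j) N) =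
      (\<Sum>j=1..l. a j * empty_coeff k l a N (r + k * j))"
  proof (subst sum.swap, rule sum.cong)
    fix j
    have "(\<Sum>h\<in>{r<..?R}. ?b (h + k * j) N) = (\<Sum>h\<in>{r + k * j<..?R + k * j}. ?b h N)"
      by (rule sum.reindex_bij_witness[of _ "\<lambda>h. h - k * j" "\<lambda>h. h + k * j"]) auto
    also have "\<dots> = empty_coeff k l a N (r + k * j)"
      by (rule empty_coeff_upto[symmetric]) auto
    finally show "(\<Sum>h\<in>{r<..?R}. a j * ?b (h + k * j) N) = a j * empty_coeff k l a N (r + k * j)"
      by (simp add: sum_distrib_left[symmetric])
  qed simp
  finally show ?thesis .
qed

section \<open>The backward equation for finitely many jumps\<close>

text \<open>
  Up to the jumps to a finite set \<open>F\<close>, the expectation of a function with values in the unit interval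
  changes in time \<open>h\<close> by at most the probability of having moved from \<open>x\<close> to a state outside \<open>F\<close>, because each
  jump changes the value by at most \<open>1\<close>. The bound does not depend on \<open>f\<close>; applied to \<open>P t z y\<close> as a function
  of \<open>z\<close>, it is therefore uniform in \<open>t\<close>.
\<close>

lemma expectation_change_bound:
  assumes P: "transition_function S P" and h: "h \<ge> 0" and x: "x \<in> S"
    and F: "finite F" "F \<subseteq> S - {x}"
    and f: "\<And>z. z \<in> S \<Longrightarrow> f z \<in> {0..1}"
    and e: "((\<lambda>z. P h x z * f z) has_sum e) S"
  shows "\<bar>e - f x - (\<Sum>z\<in>F. P h x z * (f z - f x))\<bar> \<le> 1 - P h x x - (\<Sum>z\<in>F. P h x z)"
proof -
  have nonneg: "P h x z \<ge> 0" if "z \<in> S" for z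
    using P h x that by (auto simp: transition_function_def)
  have total: "((\<lambda>z. P h x z) has_sum 1) S"
    using P h x by (auto simp: transition_function_def)
  have xF: "insert x F \<subseteq> S" "finite (insert x F)" "x \<notin> F" using x F by auto
  have "((\<lambda>z. P h x z * f z + - (P h x z * f x)) has_sum (e + - (1 * f x))) S"
    by (intro has_sum_add e has_sum_cmult_left total) (simp add: has_sum_uminus has_sum_cmult_left[OF total, simplified])
  then have "((\<lambda>z. P h x z * (f z - f x)) has_sum (e - f x)) S"
    by (simp add: algebra_simps)
  from has_sum_Diff[OF this has_sum_finite[OF xF(2)] xF(1)]
  have diff: "((\<lambda>z. P h x z * (f z - f x)) has_sum
      (e - f x - (\<Sum>z\<in>F. P h x z * (f z - f x)))) (S - insert x F)"
    using xF F by simp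
  from has_sum_Diff[OF total has_sum_finite[OF xF(2)] xF(1)]
  have rest: "((\<lambda>z. P h x z) has_sum (1 - P h x x - (\<Sum>z\<in>F. P h x z))) (S - insert x F)"
    using xF F by (simp add: algebra_simps)
  have le: "\<bar>P h x z * (f z - f x)\<bar> \<le> P h x z" if "z \<in> S" for z
  proof -
    have "\<bar>f z - f x\<bar> \<le> 1" using f[OF that] f[OF x] by auto
    then show ?thesis using nonneg[OF that] by (simp add: abs_mult mult_left_le)
  qed
  have "e - f x - (\<Sum>z\<in>F. P h x z * (f z - f x)) \<le> 1 - P h x x - (\<Sum>z\<in>F. P h x z)"
    using le by (intro has_sum_mono[OF diff rest]) (auto dest: abs_le_D1)
  moreover have "- (e - f x - (\<Sum>z\<in>F. P h x z * (f z - f x))) \<le> 1 - P h x x - (\<Sum>z\<in>F. P h x z)"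
  proof (rule has_sum_mono[OF _ rest])
    show "((\<lambda>z. - (P h x z * (f z - f x))) has_sum
        - (e - f x - (\<Sum>z\<in>F. P h x z * (f z - f x)))) (S - insert x F)"
      using diff by (simp only: has_sum_uminus minus_minus)
    show "- (P h x z * (f z - f x)) \<le> P h x z" if "z \<in> S - insert x F" for z
      using le[of z] that by (auto dest: abs_le_D2)
  qed
  ultimately show ?thesis by linarith
qed

lemma transition_function_in_unit:
  assumes "transition_function S P" "t \<ge> 0" "x \<in> S" "y \<in> S"
  shows "P t x y \<in> {0..1}"
proof -
  have nonneg: "P t x z \<ge> 0" if "z \<in> S" for z
    using assms that by (auto simp: transition_function_def)
  have "((\<lambda>z. P t x z) has_sum 1) S"
    using assms by (auto simp: transition_function_def)
  then have "sum (P t x) {y} \<le> 1"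
    by (rule has_sum_mono_neutral[OF has_sum_finite, rotated]) (use assms nonneg in auto)
  then show ?thesis using nonneg assms by auto
qed

lemma transition_function_increment:
  assumes P: "transition_function S P" and h: "h \<ge> 0" and t: "t \<ge> 0"
    and x: "x \<in> S" and y: "y \<in> S" and F: "finite F" "F \<subseteq> S - {x}"
  shows "\<bar>P (h + t) x y - P t x y - (\<Sum>z\<in>F. P h x z * (P t z y - P t x y))\<bar>
           \<le> 1 - P h x x - (\<Sum>z\<in>F. P h x z)"
  using expectation_change_bound[OF P h x F, of "\<lambda>z. P t z y" "P (h + t) x y"]
    transition_function_in_unit[OF P t _ y] P h t x y
  by (simp add: transition_function_def)

lemma filterlim_abs_diff_at_right:
  "filterlim (\<lambda>s::real. \<bar>s - t\<bar>) (at_right 0) (at t within A)"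
proof -
  have "((\<lambda>s. \<bar>s - t\<bar>) \<longlongrightarrow> \<bar>t - t\<bar>) (at t within A)"
    by (intro tendsto_intros)
  then show ?thesis
    by (auto simp: filterlim_at eventually_at_filter)
qed

text \<open>
  The case \<open>F = {}\<close> of the increment bound: the modulus of continuity is the probability of having
  left \<open>x\<close>, which tends to \<open>0\<close> by the rate condition on the diagonal.
\<close>

lemma transition_function_continuous:
  assumes P: "transition_function S P" and q: "has_transition_rates S P q"
    and x: "x \<in> S" and y: "y \<in> S"
  shows "continuous_on {0..} (\<lambda>t. P t x y)"
  unfolding continuous_on_def
proof
  fix t :: real assume "t \<in> {0..}"
  then have t: "t \<ge> 0" by simp
  let ?r = "\<Sum>\<^sub>\<infinity>z\<in>S - {x}. q x z"
  have "(\<lambda>h. 1 - P h x x - ?r * h) \<in> o[at_right 0](\<lambda>h. h)"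
    using q x by (auto simp: has_transition_rates_def)
  then have "((\<lambda>h. (1 - P h x x - ?r * h) / h) \<longlongrightarrow> 0) (at_right 0)"
    by (rule smalloD_tendsto)
  then have "((\<lambda>h. (1 - P h x x - ?r * h) / h * h + ?r * h) \<longlongrightarrow> 0 * 0 + ?r * 0) (at_right 0)"
    by (intro tendsto_intros)
  moreover have "\<forall>\<^sub>F h in at_right 0. (1 - P h x x - ?r * h) / h * h + ?r * h = 1 - P h x x"
    by (auto simp: eventually_at_filter)
  ultimately have "((\<lambda>h. 1 - P h x x) \<longlongrightarrow> 0) (at_right 0)"
    by (simp add: tendsto_cong)
  from filterlim_compose[OF this filterlim_abs_diff_at_right]
  have lim: "((\<lambda>s. 1 - P \<bar>s - t\<bar> x x) \<longlongrightarrow> 0) (at t within {0..})" .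
  have "((\<lambda>s. P s x y - P t x y) \<longlongrightarrow> 0) (at t within {0..})"
  proof (rule Lim_null_comparison[OF _ lim])
    have "norm (P s x y - P t x y) \<le> 1 - P \<bar>s - t\<bar> x x" if s: "s \<ge> 0" for s
      using transition_function_increment[OF P abs_ge_zero _ x y, of "min s t" "{}" "s - t"] s t
      by (cases "s \<le> t") (auto simp: min_def abs_minus_commute)
    then show "\<forall>\<^sub>F s in at t within {0..}. norm (P s x y - P t x y) \<le> 1 - P \<bar>s - t\<bar> x x"
      by (auto simp: eventually_at_filter)
  qed
  then show "((\<lambda>s. P s x y) \<longlongrightarrow> P t x y) (at t within {0..})"
    by (simp add: LIM_zero_iff)
qed

text \<open>
  The rate conditions concern single states and give no uniformity in the target. With finitely
  many possible jumps this costs nothing in the backward equation: what leaks to the states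
  outside \<open>insert x F\<close> is \<open>o(h)\<close>, since the diagonal condition accounts for the total
  rate. The error term \<open>\<epsilon>\<close> is uniform in the time \<open>u\<close>, so the same estimate, started at
  \<open>min s t\<close>, serves for the left and for the right difference quotient.
\<close>

lemma kolmogorov_backward:
  assumes P: "transition_function S P" and q: "has_transition_rates S P q"
    and x: "x \<in> S" and y: "y \<in> S" and F: "finite F" "F \<subseteq> S - {x}"
    and q0: "\<And>z. z \<in> S - {x} - F \<Longrightarrow> q x z = 0" and t: "t \<ge> 0"
  shows "((\<lambda>t. P t x y) has_real_derivative (\<Sum>z\<in>F. q x z * (P t z y - P t x y))) (at t within {0..})"
proof -
  define \<epsilon> where "\<epsilon> h = (\<Sum>z\<in>F. \<bar>P h x z - q x z * h\<bar>) + (1 - P h x x - (\<Sum>z\<in>F. P h x z))" for h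
  define A where "A t = (\<Sum>z\<in>F. q x z * (P t z y - P t x y))" for t
  have "(\<Sum>\<^sub>\<infinity>z\<in>S - {x}. q x z) = (\<Sum>z\<in>F. q x z)"
    using infsum_cong_neutral[of F "S - {x}" "q x" "q x"] F q0 by auto
  then have diag: "(\<lambda>h. 1 - P h x x - (\<Sum>z\<in>F. q x z) * h) \<in> o[at_right 0](\<lambda>h. h)"
    using q x by (auto simp: has_transition_rates_def)
  have off: "(\<lambda>h. P h x z - q x z * h) \<in> o[at_right 0](\<lambda>h. h)" if "z \<in> F" for z
    using q[unfolded has_transition_rates_def, THEN conjunct1, rule_format, of x z] x that F by auto
  have "(\<lambda>h. (\<Sum>z\<in>F. \<bar>P h x z - q x z * h\<bar>) +
      ((1 - P h x x - (\<Sum>z\<in>F. q x z) * h) - (\<Sum>z\<in>F. P h x z - q x z * h))) \<in> o[at_right 0](\<lambda>h. h)"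
    by (rule sum_in_smallo(1)[OF big_sum_in_smallo sum_in_smallo(2)[OF diag big_sum_in_smallo]])
      (auto intro: off)
  also have "(\<lambda>h. (\<Sum>z\<in>F. \<bar>P h x z - q x z * h\<bar>) +
      ((1 - P h x x - (\<Sum>z\<in>F. q x z) * h) - (\<Sum>z\<in>F. P h x z - q x z * h))) = \<epsilon>"
    by (simp add: \<epsilon>_def fun_eq_iff sum_subtractf sum_distrib_right)
  finally have "((\<lambda>h. \<epsilon> h / h) \<longlongrightarrow> 0) (at_right 0)"
    by (rule smalloD_tendsto)
  from filterlim_compose[OF this filterlim_abs_diff_at_right]
  have lim: "((\<lambda>s. \<epsilon> \<bar>s - t\<bar> / \<bar>s - t\<bar>) \<longlongrightarrow> 0) (at t within {0..})" .
  have incr: "\<bar>P (h + u) x y - P u x y - h * A u\<bar> \<le> \<epsilon> h" if "h \<ge> 0" "u \<ge> 0" for h u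
  proof -
    have unit: "\<bar>P u z y - P u x y\<bar> \<le> 1" if "z \<in> F" for z
    proof -
      have "z \<in> S" using that F by auto
      then have "P u z y \<in> {0..1}" "P u x y \<in> {0..1}"
        using transition_function_in_unit[OF P \<open>u \<ge> 0\<close> _ y] x by blast+
      then show ?thesis by (simp add: abs_le_iff)
    qed
    have "\<bar>(\<Sum>z\<in>F. P h x z * (P u z y - P u x y)) - h * A u\<bar>
        = \<bar>\<Sum>z\<in>F. (P h x z - q x z * h) * (P u z y - P u x y)\<bar>"
      unfolding A_def sum_distrib_left sum_subtractf[symmetric]
      by (intro arg_cong[where f = abs] sum.cong refl) (simp add: algebra_simps)
    also have "\<dots> \<le> (\<Sum>z\<in>F. \<bar>(P h x z - q x z * h) * (P u z y - P u x y)\<bar>)"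
      by (rule sum_abs)
    also have "\<dots> \<le> (\<Sum>z\<in>F. \<bar>P h x z - q x z * h\<bar>)"
      by (rule sum_mono) (simp add: abs_mult mult_left_le unit)
    finally have "\<bar>(\<Sum>z\<in>F. P h x z * (P u z y - P u x y)) - h * A u\<bar> \<le> \<dots>" .
    with transition_function_increment[OF P that x y F] show ?thesis
      unfolding \<epsilon>_def abs_le_iff by linarith
  qed
  have contA: "continuous_on {0..} A"
    unfolding A_def using F x
    by (intro continuous_intros transition_function_continuous[OF P q]) (auto intro: y)
  have "((\<lambda>s. min s t) \<longlongrightarrow> min t t) (at t within {0..})"
    by (intro tendsto_intros)
  then have minA: "((\<lambda>s. A (min s t)) \<longlongrightarrow> A t) (at t within {0..})"
    using continuous_on_tendsto_compose[OF contA, of "\<lambda>s. min s t" t] t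
    by (auto simp: eventually_at_filter)
  have "((\<lambda>s. (P s x y - P t x y) / (s - t) - A (min s t)) \<longlongrightarrow> 0) (at t within {0..})"
  proof (rule Lim_null_comparison[OF _ lim])
    have "norm ((P s x y - P t x y) / (s - t) - A (min s t)) \<le> \<epsilon> \<bar>s - t\<bar> / \<bar>s - t\<bar>"
      if s: "s \<ge> 0" "s \<noteq> t" for s
    proof -
      have "\<bar>P s x y - P t x y - (s - t) * A (min s t)\<bar> \<le> \<epsilon> \<bar>s - t\<bar>"
        using incr[OF abs_ge_zero, of "min s t" "s - t"] s t
        by (cases "s \<le> t") (auto simp: min_def abs_le_iff algebra_simps)
      moreover have "(P s x y - P t x y) / (s - t) - A (min s t)
          = (P s x y - P t x y - (s - t) * A (min s t)) / (s - t)"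
        using s by (simp add: field_simps)
      ultimately show ?thesis
        by (simp add: divide_right_mono)
    qed
    then show "\<forall>\<^sub>F s in at t within {0..}.
        norm ((P s x y - P t x y) / (s - t) - A (min s t)) \<le> \<epsilon> \<bar>s - t\<bar> / \<bar>s - t\<bar>"
      by (auto simp: eventually_at_filter)
  qed
  from tendsto_add[OF this minA] show ?thesis
    by (simp add: has_field_derivative_iff A_def)
qed

section \<open>The generator of the Erlang queue\<close>

definition arrive :: "nat \<Rightarrow> nat \<Rightarrow> nat \<times> nat \<Rightarrow> nat \<times> nat" where
  "arrive k m x = (fst x + m, if fst x = 0 then k else snd x)"

text \<open>
  The last branch also fixes the empty state, where a fictitious phase completion at rate
  \<open>k * \<mu>\<close> takes place; then all states have the same total rate.
\<close>

definition complete_phase :: "nat \<Rightarrow> nat \<times> nat \<Rightarrow> nat \<times> nat" where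
  "complete_phase k x =
     (if snd x \<ge> 2 then (fst x, snd x - 1) else if fst x \<ge> 2 then (fst x - 1, k) else (0, 0))"

text \<open>
  The number of service phases still to be completed by all customers present. It determines the
  state, and in terms of it arrivals add \<open>k * m\<close> and service subtracts one.
\<close>

definition phases :: "nat \<Rightarrow> nat \<times> nat \<Rightarrow> nat" where
  "phases k x = (if fst x = 0 then 0 else k * (fst x - 1) + snd x)"

text \<open>
  The uniformised generator in units of the service rate \<open>k * \<mu>\<close>: the generator plus \<open>1 + \<eta>\<close> times the
  identity, if \<open>a\<close> are the normalised arrival rates and \<open>\<eta>\<close> is their sum.
\<close>

definition queue_step ::
    "nat \<Rightarrow> nat \<Rightarrow> (nat \<Rightarrow> real) \<Rightarrow> (nat \<times> nat \<Rightarrow> real) \<Rightarrow> nat \<times> nat \<Rightarrow> real" where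
  "queue_step k l a f x = f (complete_phase k x) + (\<Sum>m=1..l. a m * f (arrive k m x))"

lemma arrive_in_states:
  assumes "k \<ge> 1" "m \<ge> 1" "x \<in> erlang_states k"
  shows "arrive k m x \<in> erlang_states k"
  using assms by (auto simp: erlang_states_def arrive_def)

lemma complete_phase_in_states:
  assumes "k \<ge> 1" "x \<in> erlang_states k"
  shows "complete_phase k x \<in> erlang_states k"
  using assms by (auto simp: erlang_states_def complete_phase_def)

lemma phases_eq_0_iff:
  assumes "x \<in> erlang_states k"
  shows "phases k x = 0 \<longleftrightarrow> x = (0, 0)"
  using assms by (auto simp: erlang_states_def phases_def)

lemma phases_arrive:
  assumes "m \<ge> 1" "x \<in> erlang_states k"
  shows "phases k (arrive k m x) = phases k x + k * m"
proof (cases "fst x")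
  case 0
  then show ?thesis using assms by (cases m) (auto simp: phases_def arrive_def)
next
  case (Suc n)
  then show ?thesis by (simp add: phases_def arrive_def algebra_simps)
qed

lemma phases_complete_phase:
  assumes "x \<in> erlang_states k"
  shows "phases k (complete_phase k x) = phases k x - 1"
proof -
  obtain n s where x: "x = (n, s)" by (cases x)
  consider "n = 0" "s = 0" | "n = 1" "s = 1" | n' where "n = Suc (Suc n')" "s = 1" | "n \<ge> 1" "s \<ge> 2"
  proof -
    have "n = 0 \<and> s = 0 \<or> n \<ge> 1 \<and> s \<ge> 1" using assms by (auto simp: x erlang_states_def)
    moreover have "n = 0 \<or> n = 1 \<or> (\<exists>n'. n = Suc (Suc n'))" by (metis One_nat_def not0_implies_Suc)
    ultimately show ?thesis using that by (cases "s \<ge> 2") auto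
  qed
  then show ?thesis by cases (auto simp: x phases_def complete_phase_def)
qed

lemma arrival_iff:
  assumes "x \<in> erlang_states k"
  shows "arrival k m x y \<longleftrightarrow> y = arrive k m x"
  using assms by (auto simp: arrival.simps arrive_def erlang_states_def)

lemma phase_completion_iff:
  assumes "k \<ge> 1" "x \<in> erlang_states k"
  shows "phase_completion k x y \<longleftrightarrow> x \<noteq> (0, 0) \<and> y = complete_phase k x"
proof -
  obtain n s where x: "x = (n, s)" by (cases x)
  have "n = 0 \<and> s = 0 \<or> n \<ge> 1 \<and> s \<ge> 1 \<and> s \<le> k" using assms by (auto simp: x erlang_states_def)
  then consider "n = 0" "s = 0" | "n = 1" "s = 1" | "n \<ge> 2" "s = 1" | "n \<ge> 1" "s \<ge> 2" "s \<le> k"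
    by linarith
  then show ?thesis
    by cases (auto simp: x phase_completion.simps complete_phase_def)
qed

lemma funpow_queue_step_empty:
  assumes k: "k \<ge> 1" and x: "x \<in> erlang_states k"
  shows "(queue_step k l a ^^ N) (\<lambda>x. of_bool (x = (0, 0))) x = fact N * empty_coeff k l a N (phases k x)"
  using x
proof (induction N arbitrary: x)
  case 0
  then show ?case by (simp add: empty_coeff_0 phases_eq_0_iff)
next
  case (Suc N)
  have "(queue_step k l a ^^ Suc N) (\<lambda>x. of_bool (x = (0, 0))) x =
      fact N * empty_coeff k l a N (phases k x - 1) +
      (\<Sum>m=1..l. a m * (fact N * empty_coeff k l a N (phases k x + k * m)))"
    using Suc k
    by (simp add: queue_step_def[where x = x] complete_phase_in_states phases_complete_phase
        arrive_in_states phases_arrive)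
  also have "\<dots> = fact N * (empty_coeff k l a N (phases k x - 1) +
      (\<Sum>m=1..l. a m * empty_coeff k l a N (phases k x + k * m)))"
    by (simp add: sum_distrib_left algebra_simps)
  also have "\<dots> = fact (Suc N) * empty_coeff k l a (Suc N) (phases k x)"
    by (simp only: empty_coeff_Suc[symmetric] fact_Suc of_nat_mult) (simp only: mult_ac)
  finally show ?case .
qed

lemma sum_of_bool_eq_mult:
  fixes g :: "'s \<Rightarrow> real"
  assumes "finite F" "w \<in> insert x F" "x \<notin> F"
  shows "(\<Sum>z\<in>F. of_bool (z = w) * (g z - g x)) = g w - g x"
proof (cases "w \<in> F")
  case True
  then have "(\<Sum>z\<in>F. of_bool (z = w) * (g z - g x)) = (\<Sum>z\<in>F. if z = w then g w - g x else 0)"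
    by (intro sum.cong) auto
  then show ?thesis using assms True by simp
next
  case False
  then have "(\<Sum>z\<in>F. of_bool (z = w) * (g z - g x)) = 0"
    by (intro sum.neutral) auto
  then show ?thesis using assms False by simp
qed

text \<open>
  At the empty state the service term contributes \<open>P t x y - P t x y\<close>, so adding the fictitious
  completion does not change the generator.
\<close>

lemma erlang_backward:
  assumes k: "k \<ge> 1" and \<kappa>: "\<kappa> = real k * \<mu>" "\<kappa> > 0"
    and P: "transition_function (erlang_states k) P"
    and q: "has_transition_rates (erlang_states k) P (erlang_rate k l \<mu> lam)"
    and x: "x \<in> erlang_states k" and y: "y \<in> erlang_states k" and t: "t \<ge> 0"
  shows "((\<lambda>t. P t x y) has_real_derivative
     \<kappa> * queue_step k l (\<lambda>m. lam m / \<kappa>) (\<lambda>z. P t z y) x - (\<kappa> + (\<Sum>m=1..l. lam m)) * P t x y)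
     (at t within {0..})"
proof -
  define F where "F = insert (complete_phase k x) ((\<lambda>m. arrive k m x) ` {1..l}) - {x}"
  define g where "g z = P t z y" for z
  have F: "finite F" "F \<subseteq> erlang_states k - {x}" "x \<notin> F"
    using complete_phase_in_states[OF k x] arrive_in_states[OF k _ x] unfolding F_def
    by (simp, intro Diff_mono insert_subsetI, simp_all add: image_subset_iff)
  have rate: "erlang_rate k l \<mu> lam x z = (\<Sum>m=1..l. lam m * of_bool (z = arrive k m x)) +
      \<kappa> * of_bool (x \<noteq> (0, 0) \<and> z = complete_phase k x)" for z
    using k x by (simp add: erlang_rate_def arrival_iff phase_completion_iff \<kappa>)
  have "(\<Sum>z\<in>F. erlang_rate k l \<mu> lam x z * (g z - g x)) =
      (\<Sum>m=1..l. lam m * (\<Sum>z\<in>F. of_bool (z = arrive k m x) * (g z - g x))) +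
      \<kappa> * (\<Sum>z\<in>F. of_bool (x \<noteq> (0, 0) \<and> z = complete_phase k x) * (g z - g x))"
    unfolding rate distrib_right sum.distrib sum_distrib_left sum_distrib_right
    by (subst sum.swap) (simp add: mult.assoc)
  also have "(\<Sum>z\<in>F. of_bool (x \<noteq> (0, 0) \<and> z = complete_phase k x) * (g z - g x)) =
      g (complete_phase k x) - g x"
  proof (cases "x = (0, 0)")
    case True
    then show ?thesis by (simp add: complete_phase_def)
  next
    case False
    then show ?thesis
      using sum_of_bool_eq_mult[OF F(1) _ F(3), of "complete_phase k x" g] by (auto simp: F_def)
  qed
  also have "(\<Sum>m=1..l. lam m * (\<Sum>z\<in>F. of_bool (z = arrive k m x) * (g z - g x))) =
      (\<Sum>m=1..l. lam m * (g (arrive k m x) - g x))"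
    using F by (intro sum.cong refl arg_cong2[where f = "(*)"] sum_of_bool_eq_mult) (auto simp: F_def)
  also have "\<dots> + \<kappa> * (g (complete_phase k x) - g x) =
      \<kappa> * queue_step k l (\<lambda>m. lam m / \<kappa>) g x - (\<kappa> + (\<Sum>m=1..l. lam m)) * g x"
    using \<kappa>(2) by (simp add: queue_step_def algebra_simps sum_subtractf sum_distrib_left sum_distrib_right)
  finally have "(\<Sum>z\<in>F. erlang_rate k l \<mu> lam x z * (P t z y - P t x y)) =
      \<kappa> * queue_step k l (\<lambda>m. lam m / \<kappa>) (\<lambda>z. P t z y) x - (\<kappa> + (\<Sum>m=1..l. lam m)) * P t x y"
    by (simp add: g_def[abs_def])
  moreover have "erlang_rate k l \<mu> lam x z = 0" if "z \<in> erlang_states k - {x} - F" for z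
    unfolding rate using that by (auto simp: F_def intro!: sum.neutral)
  ultimately show ?thesis
    using kolmogorov_backward[OF P q x y F(1,2) _ t] by simp
qed

lemma queue_step_scale: "queue_step k l a (\<lambda>z. c * f z) x = c * queue_step k l a f x"
  by (simp add: queue_step_def sum_distrib_left algebra_simps)

lemma funpow_queue_step_bound:
  assumes k: "k \<ge> 1" and a: "\<And>m. m \<in> {1..l} \<Longrightarrow> a m \<ge> 0" 
    and f: "\<And>x. x \<in> erlang_states k \<Longrightarrow> \<bar>f x\<bar> \<le> C" and x: "x \<in> erlang_states k"
  shows "\<bar>(queue_step k l a ^^ n) f x\<bar> \<le> (1 + (\<Sum>m=1..l. a m)) ^ n * C"
  using x
proof (induction n arbitrary: x)
  case (Suc n)
  let ?g = "(queue_step k l a ^^ n) f" and ?K = "(1 + (\<Sum>m=1..l. a m)) ^ n * C"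
  have "\<bar>queue_step k l a ?g x\<bar> \<le> \<bar>?g (complete_phase k x)\<bar> + \<bar>\<Sum>m=1..l. a m * ?g (arrive k m x)\<bar>"
    unfolding queue_step_def by (rule abs_triangle_ineq)
  also have "\<dots> \<le> \<bar>?g (complete_phase k x)\<bar> + (\<Sum>m=1..l. \<bar>a m * ?g (arrive k m x)\<bar>)"
    by (intro add_left_mono sum_abs)
  also have "\<dots> \<le> ?K + (\<Sum>m=1..l. a m * ?K)"
  proof (intro add_mono sum_mono)
    show "\<bar>?g (complete_phase k x)\<bar> \<le> ?K"
      by (intro Suc complete_phase_in_states k)
    fix m assume m: "m \<in> {1..l}"
    then have "\<bar>?g (arrive k m x)\<bar> \<le> ?K"
      by (intro Suc arrive_in_states k) auto
    then show "\<bar>a m * ?g (arrive k m x)\<bar> \<le> a m * ?K"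
      using a[OF m] by (simp add: abs_mult mult_left_mono)
  qed
  also have "\<dots> = (1 + (\<Sum>m=1..l. a m)) ^ Suc n * C"
    by (subst sum_distrib_right[symmetric]) (simp add: algebra_simps)
  finally show ?case by simp
qed (use f in simp)

text \<open>
  The function \<open>V\<close>, a probability times \<open>exp (\<theta> * t)\<close>, satisfies \<open>V' = \<kappa> * queue_step V\<close>, so each
  derivative in \<open>t\<close> is an application of the bounded operator \<open>\<kappa> * queue_step\<close>, and the Taylor
  remainder on \<open>{0..t}\<close> vanishes in the limit. The Taylor coefficients at \<open>0\<close> are iterates applied to
  the indicator of the empty state. This proves that the rates determine the probability and
  computes it at the same time.
\<close>

lemma erlang_empty_probability_series:
  assumes k: "k \<ge> 1" and \<kappa>: "\<kappa> = real k * \<mu>" "\<kappa> > 0"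
    and lam: "\<And>m. m \<in> {1..l} \<Longrightarrow> lam m \<ge> 0"
    and P: "transition_function (erlang_states k) P"
    and q: "has_transition_rates (erlang_states k) P (erlang_rate k l \<mu> lam)"
    and x: "x \<in> erlang_states k" and t: "t \<ge> 0"
  shows "(\<lambda>N. empty_coeff k l (\<lambda>m. lam m / \<kappa>) N (phases k x) * (\<kappa> * t) ^ N)
           sums (exp ((\<kappa> + (\<Sum>m=1..l. lam m)) * t) * P t x (0, 0))"
proof -
  define a where "a m = lam m / \<kappa>" for m
  define \<theta> where "\<theta> = \<kappa> + (\<Sum>m=1..l. lam m)"
  define V where "V t x = exp (\<theta> * t) * P t x (0, 0)" for t x
  define D where "D n t = \<kappa> ^ n * (queue_step k l a ^^ n) (V t) x" for n t
  have 0: "(0, 0) \<in> erlang_states k" by (simp add: erlang_states_def)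
  have a: "a m \<ge> 0" if "m \<in> {1..l}" for m using lam[OF that] \<kappa>(2) by (simp add: a_def)
  have \<theta>: "\<theta> \<ge> 0" using lam \<kappa>(2) by (auto simp: \<theta>_def intro!: add_nonneg_nonneg sum_nonneg)
  have der_V: "((\<lambda>t. V t z) has_real_derivative \<kappa> * queue_step k l a (V u) z) (at u within {0..})"
    if "z \<in> erlang_states k" "u \<ge> 0" for z u
  proof -
    have "((\<lambda>u. exp (\<theta> * u)) has_real_derivative \<theta> * exp (\<theta> * u)) (at u within {0..})"
      by (auto intro!: derivative_eq_intros)
    from DERIV_mult'[OF this erlang_backward[OF k \<kappa> P q that(1) 0 that(2)]]
    have "((\<lambda>t. V t z) has_real_derivative
        exp (\<theta> * u) * (\<kappa> * queue_step k l a (\<lambda>z. P u z (0, 0)) z - \<theta> * P u z (0, 0)) +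
        \<theta> * exp (\<theta> * u) * P u z (0, 0)) (at u within {0..})"
      by (simp add: V_def \<theta>_def a_def[abs_def])
    moreover have "queue_step k l a (V u) z = exp (\<theta> * u) * queue_step k l a (\<lambda>z. P u z (0, 0)) z"
      unfolding V_def[abs_def] by (rule queue_step_scale)
    ultimately show ?thesis by (simp add: algebra_simps)
  qed
  have der: "((\<lambda>t. (queue_step k l a ^^ n) (V t) z) has_real_derivative
      \<kappa> * (queue_step k l a ^^ Suc n) (V u) z) (at u within {0..})"
    if "z \<in> erlang_states k" "u \<ge> 0" for z u n
    using that(1)
  proof (induction n arbitrary: z)
    case 0
    then show ?case using der_V that(2) by simp
  next
    case (Suc n)
    have "((\<lambda>t. queue_step k l a ((queue_step k l a ^^ n) (V t)) z) has_real_derivative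
        \<kappa> * (queue_step k l a ^^ Suc n) (V u) (complete_phase k z) +
        (\<Sum>m=1..l. a m * (\<kappa> * (queue_step k l a ^^ Suc n) (V u) (arrive k m z)))) (at u within {0..})"
      unfolding queue_step_def[where x = z] using Suc.prems k
      by (intro DERIV_add DERIV_sum DERIV_cmult Suc.IH complete_phase_in_states arrive_in_states) auto
    also have "\<kappa> * (queue_step k l a ^^ Suc n) (V u) (complete_phase k z) +
        (\<Sum>m=1..l. a m * (\<kappa> * (queue_step k l a ^^ Suc n) (V u) (arrive k m z))) =
        \<kappa> * queue_step k l a ((queue_step k l a ^^ Suc n) (V u)) z"
      by (simp only: queue_step_def[where x = z] sum_distrib_left distrib_left mult.left_commute)
    finally show ?case by simp
  qed
  define X where "X = \<kappa> * (1 + (\<Sum>m=1..l. a m))"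
  have taylor: "\<bar>D 0 t - (\<Sum>i\<le>n. D i 0 * t ^ i / fact i)\<bar> \<le> X * t * exp (\<theta> * t) * ((X * t) ^ n /\<^sub>R fact n)"
    for n
  proof -
    have "norm (D 0 t - (\<Sum>i\<le>n. D i 0 * (t - 0) ^ i / fact i))
        \<le> (X ^ Suc n * exp (\<theta> * t)) * norm (t - 0) ^ Suc n / fact n"
    proof (rule field_Taylor[where S = "{0..t}"])
      show "(D i has_field_derivative D (Suc i) u) (at u within {0..t})" if "u \<in> {0..t}" for i u
      proof -
        have "((\<lambda>t. \<kappa> ^ i * (queue_step k l a ^^ i) (V t) x) has_field_derivative
            \<kappa> ^ i * (\<kappa> * (queue_step k l a ^^ Suc i) (V u) x)) (at u within {0..})"
          using that by (intro DERIV_cmult der x) auto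
        then have "(D i has_field_derivative D (Suc i) u) (at u within {0..})"
          by (simp add: D_def[abs_def] mult_ac)
        then show ?thesis by (rule DERIV_subset) auto
      qed
      show "norm (D (Suc n) u) \<le> X ^ Suc n * exp (\<theta> * t)" if u: "u \<in> {0..t}" for u
      proof -
        have "\<bar>V u z\<bar> \<le> exp (\<theta> * t)" if "z \<in> erlang_states k" for z
        proof -
          have "exp (\<theta> * u) \<le> exp (\<theta> * t)" using u \<theta> by (simp add: mult_left_mono)
          moreover have "P u z (0, 0) \<in> {0..1}"
            using transition_function_in_unit[OF P _ that 0] u by simp
          ultimately show ?thesis
            using mult_mono[of "exp (\<theta> * u)" "exp (\<theta> * t)" "P u z (0, 0)" 1] by (simp add: V_def abs_mult)
        qed
        then have "\<bar>(queue_step k l a ^^ Suc n) (V u) x\<bar> \<le> (1 + (\<Sum>m=1..l. a m)) ^ Suc n * exp (\<theta> * t)"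
          by (intro funpow_queue_step_bound k a x)
        then have "\<kappa> ^ Suc n * \<bar>(queue_step k l a ^^ Suc n) (V u) x\<bar>
            \<le> \<kappa> ^ Suc n * ((1 + (\<Sum>m=1..l. a m)) ^ Suc n * exp (\<theta> * t))"
          by (rule mult_left_mono) (use \<kappa>(2) in simp)
        moreover have "norm (D (Suc n) u) = \<kappa> ^ Suc n * \<bar>(queue_step k l a ^^ Suc n) (V u) x\<bar>"
          using \<kappa>(2) by (simp only: D_def real_norm_def abs_mult) simp
        ultimately show ?thesis
          by (simp only: X_def power_mult_distrib mult.assoc)
      qed
    qed (use t in auto)
    then show ?thesis using t by (simp add: field_simps)
  qed
  have "(\<lambda>n. X * t * exp (\<theta> * t) * ((X * t) ^ n /\<^sub>R fact n)) \<longlonglongrightarrow> X * t * exp (\<theta> * t) * 0"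
    by (intro tendsto_intros summable_LIMSEQ_zero summable_exp_generic)
  then have "(\<lambda>n. X * t * exp (\<theta> * t) * ((X * t) ^ n /\<^sub>R fact n)) \<longlonglongrightarrow> 0" by simp
  from Lim_null_comparison[OF always_eventually this, of "\<lambda>n. D 0 t - (\<Sum>i\<le>n. D i 0 * t ^ i / fact i)"] taylor
  have "(\<lambda>n. D 0 t - (\<Sum>i\<le>n. D i 0 * t ^ i / fact i)) \<longlonglongrightarrow> 0" by simp
  then have "(\<lambda>n. D 0 t - (D 0 t - (\<Sum>i\<le>n. D i 0 * t ^ i / fact i))) \<longlonglongrightarrow> D 0 t - 0"
    by (intro tendsto_intros)
  then have sums: "(\<lambda>i. D i 0 * t ^ i / fact i) sums D 0 t"
    by (simp add: sums_def_le)
  \<comment> \<open>At time 0 the function is the indicator only on the state space, so the iterates are compared there.\<close>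
  have init: "(queue_step k l a ^^ n) (V 0) z = (queue_step k l a ^^ n) (\<lambda>x. of_bool (x = (0, 0))) z"
    if "z \<in> erlang_states k" for n z
    using that
  proof (induction n arbitrary: z)
    case 0
    then show ?case using P \<open>(0, 0) \<in> _\<close> by (simp add: V_def transition_function_def)
  next
    case (Suc n)
    then show ?case using k
      by (simp add: queue_step_def[where x = z] complete_phase_in_states arrive_in_states)
  qed
  have "D i 0 * t ^ i / fact i = empty_coeff k l a i (phases k x) * (\<kappa> * t) ^ i" for i
    by (simp add: D_def init[OF x] funpow_queue_step_empty[OF k x] power_mult_distrib)
  with sums show ?thesis
    by (simp add: D_def V_def \<theta>_def a_def[abs_def])
qed

section \<open>Rearranging the series\<close>

text \<open>
  Here and below the index \<open>h\<close> starts at \<open>0\<close> and stands for the level \<open>Suc h\<close>, which turns the exponent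
  \<open>h + n + k * w - 1\<close> into a sum without subtraction.
\<close>

lemma sum_finite_fibre_empty_coeff:
  fixes \<tau> :: real and k l :: nat and a :: "nat \<Rightarrow> real"
  defines "G \<equiv> \<lambda>(h, m). real (Suc h) * (arrival_weight l a m * (\<tau> ^ (h + arrivals l m + k * customers l m) /
            fact (Suc h + k * customers l m)))"
  defines "J \<equiv> \<lambda>N. {(h, m). m \<in> arrival_vectors l \<and> h + arrivals l m + k * customers l m = N}"
  shows "finite (J N)" and "(\<Sum>p\<in>J N. G p) = empty_coeff k l a N 0 * \<tau> ^ N"
proof -
  let ?S = "SIGMA h:{0<..Suc N}. passages k l h N"
  have bij: "bij_betw (\<lambda>(h, m). (h - 1, m)) ?S (J N)"
    by (rule bij_betw_byWitness[where f' = "\<lambda>(h, m). (Suc h, m)"]) (auto simp: J_def passages_def)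
  have "finite ?S"
    by (intro finite_SigmaI finite_passages) simp
  then show "finite (J N)"
    using bij_betw_finite[OF bij] by simp
  have "(\<Sum>p\<in>J N. G p) = (\<Sum>p\<in>?S. G (case p of (h, m) \<Rightarrow> (h - 1, m)))"
    by (rule sum.reindex_bij_betw[OF bij, symmetric])
  also have "\<dots> = (\<Sum>(h, m)\<in>?S. real h * arrival_weight l a m / fact (h + k * customers l m) * \<tau> ^ N)"
  proof (rule sum.cong)
    fix p assume "p \<in> ?S"
    then obtain h m where p: "p = (Suc h, m)" "m \<in> passages k l (Suc h) N"
      by (auto simp: gr0_conv_Suc)
    then have "h + arrivals l m + k * customers l m = N" by (simp add: passages_def)
    then show "G (case p of (h, m) \<Rightarrow> (h - 1, m)) = (case p of (h, m) \<Rightarrow>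
        real h * arrival_weight l a m / fact (h + k * customers l m) * \<tau> ^ N)"
      by (simp only: p(1) G_def prod.case diff_Suc_1) simp
  qed simp
  also have "\<dots> = empty_coeff k l a N 0 * \<tau> ^ N"
    by (simp add: empty_coeff_def passage_coeff_def sum_distrib_right sum.Sigma[symmetric] finite_passages)
  finally show "(\<Sum>p\<in>J N. G p) = empty_coeff k l a N 0 * \<tau> ^ N" .
qed

text \<open>
  All terms are nonnegative, so the double series may be summed in any order: the power series
  groups the pairs \<open>(h, m)\<close> by the exponent of \<open>\<tau>\<close>, the other series first by \<open>h\<close> and then by the
  number of batches.
\<close>

lemma empty_series_by_passage_level:
  fixes \<tau> s :: real and k l :: nat and a :: "nat \<Rightarrow> real"
  assumes a: "\<And>i. i \<in> {1..l} \<Longrightarrow> a i \<ge> 0" and \<tau>: "\<tau> \<ge> 0"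
    and s: "(\<lambda>N. empty_coeff k l a N 0 * \<tau> ^ N) sums s"
  defines "T \<equiv> \<lambda>h n. \<Sum>m\<in>compositions l n. real (Suc h) * (arrival_weight l a m *
       (\<tau> ^ (h + n + k * customers l m) / fact (Suc h + k * customers l m)))"
  shows "summable (T h)" and "(\<lambda>h. \<Sum>n. T h n) sums s"
proof -
  define G where "G = (\<lambda>(h, m). real (Suc h) * (arrival_weight l a m *
      (\<tau> ^ (h + arrivals l m + k * customers l m) / fact (Suc h + k * customers l m))))"
  define J where "J N = {(h, m). m \<in> arrival_vectors l \<and> h + arrivals l m + k * customers l m = N}" for N
  define E where "E = arrival_vectors l"
  have J: "finite (J N)" "(\<Sum>p\<in>J N. G p) = empty_coeff k l a N 0 * \<tau> ^ N" for N
    unfolding G_def J_def by (rule sum_finite_fibre_empty_coeff)+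
  have nonneg: "G p \<ge> 0" for p
    unfolding G_def case_prod_beta
    by (intro mult_nonneg_nonneg divide_nonneg_nonneg prod_nonneg ballI zero_le_power fact_ge_zero
        of_nat_0_le_iff a \<tau>)
  have inner: "((\<lambda>p. G (snd (N, p))) has_sum (empty_coeff k l a N 0 * \<tau> ^ N)) (J N)" for N
    using has_sum_finite[OF J(1), of G N] by (simp add: J(2))
  have coeff_nonneg: "empty_coeff k l a N 0 * \<tau> ^ N \<ge> 0" for N
    unfolding J(2)[symmetric] by (rule sum_nonneg) (rule nonneg)
  have outer: "((\<lambda>N. empty_coeff k l a N 0 * \<tau> ^ N) has_sum s) UNIV"
    using s coeff_nonneg by (intro sums_nonneg_imp_has_sum) auto
  have "((\<lambda>z. G (snd z)) has_sum s) (Sigma UNIV J)"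
    by (intro has_sum_SigmaI[OF inner outer] summable_on_SigmaI[OF inner]
        has_sum_imp_summable[OF outer] nonneg)
  moreover have "bij_betw snd (Sigma UNIV J) (UNIV \<times> arrival_vectors l)"
    by (rule bij_betw_byWitness[where f' = "\<lambda>(h, m). (h + arrivals l m + k * customers l m, h, m)"])
      (unfold J_def E_def[symmetric], auto)
  ultimately have pairs: "(G has_sum s) (UNIV \<times> arrival_vectors l)"
    by (simp only: has_sum_reindex_bij_betw)
  have bij: "bij_betw (\<lambda>(h, n, m). (h, m)) (SIGMA h:UNIV. SIGMA n:UNIV. compositions l n)
      (UNIV \<times> arrival_vectors l)"
    by (rule bij_betw_byWitness[where f' = "\<lambda>(h, m). (h, arrivals l m, m)"])
      (unfold compositions_def E_def[symmetric], auto)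
  have total: "((\<lambda>z. G (case z of (h, n, m) \<Rightarrow> (h, m))) has_sum s)
      (SIGMA h:UNIV. SIGMA n:UNIV. compositions l n)"
    by (rule has_sum_reindex_bij_betw[OF bij, THEN iffD2, OF pairs])
  have summ: "(\<lambda>(n, m). G (h, m)) summable_on (SIGMA n:UNIV. compositions l n)" for h
  proof (rule summable_on_SigmaD1[where f = "\<lambda>h (n, m). G (h, m)" and x = h])
    show "(\<lambda>(h, z). case z of (n, m) \<Rightarrow> G (h, m)) summable_on
        (SIGMA h:UNIV. SIGMA n:UNIV. compositions l n)"
      using has_sum_imp_summable[OF total] by (simp add: split_def)
  qed simp
  define I where "I h = infsum (\<lambda>(n, m). G (h, m)) (SIGMA n:UNIV. compositions l n)" for h
  have I: "((\<lambda>(n, m). G (h, m)) has_sum I h) (SIGMA n:UNIV. compositions l n)" for h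
    unfolding I_def by (rule has_sum_infsum[OF summ])
  have "((\<lambda>n. \<Sum>m\<in>compositions l n. G (h, m)) has_sum I h) UNIV" for h
    by (rule has_sum_SigmaD[OF I]) (simp add: finite_compositions)
  moreover have "(\<Sum>m\<in>compositions l n. G (h, m)) = T h n" for h n
    unfolding T_def by (rule sum.cong) (auto simp: G_def compositions_def)
  ultimately have "(T h has_sum I h) UNIV" for h
    by (simp cong: has_sum_cong)
  then have sums_I: "T h sums I h" for h
    by (rule has_sum_imp_sums)
  then show "summable (T h)" by (rule sums_summable)
  have "(I has_sum s) UNIV"
  proof (rule has_sum_SigmaD[OF total])
    fix h :: nat
    show "((\<lambda>y. G (case (h, y) of (h, n, m) \<Rightarrow> (h, m))) has_sum I h) (SIGMA n:UNIV. compositions l n)"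
      using I[of h] by (simp add: split_def)
  qed
  then show "(\<lambda>h. \<Sum>n. T h n) sums s"
    using sums_I by (simp add: sums_iff has_sum_imp_sums[THEN sums_summable] has_sum_imp_sums[THEN sums_unique, symmetric])
qed

lemma erlang_summand_1:
  assumes l: "\<And>m. m \<in> {1..l} \<Longrightarrow> a m = \<eta> * c m"
  shows "erlang_summand 1 k l \<eta> c \<tau> (Suc h) n =
    exp (- (1 + \<eta>) * \<tau>) * (\<Sum>m\<in>compositions l n. arrival_weight l a m *
       (\<tau> ^ (h + n + k * customers l m) / fact (Suc h + k * customers l m)))"
proof -
  have weight: "\<eta> ^ n * (\<Prod>i=1..l. c i ^ m i / fact (m i)) = arrival_weight l a m"
    if "m \<in> compositions l n" for m
  proof -
    have "\<eta> ^ n = (\<Prod>i=1..l. \<eta> ^ m i)"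
      using that by (auto simp: compositions_def power_sum[symmetric])
    then have "\<eta> ^ n * (\<Prod>i=1..l. c i ^ m i / fact (m i)) =
        (\<Prod>i=1..l. \<eta> ^ m i * (c i ^ m i / fact (m i)))"
      by (simp only: prod.distrib)
    also have "\<dots> = arrival_weight l a m"
      by (rule prod.cong) (use l in \<open>auto simp: power_mult_distrib\<close>)
    finally show ?thesis .
  qed
  have "erlang_summand 1 k l \<eta> c \<tau> (Suc h) n = (\<Sum>m\<in>compositions l n.
      \<eta> ^ n * ((\<Prod>i=1..l. c i ^ m i / fact (m i)) *
           (\<tau> ^ (Suc h + n + k * customers l m - 1) / fact (Suc h + k * customers l m)) *
           exp (- (1 + \<eta>) * \<tau>)))"
    unfolding erlang_summand_def by (rule sum_distrib_left)
  also have "\<dots> = (\<Sum>m\<in>compositions l n. exp (- (1 + \<eta>) * \<tau>) *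
         (arrival_weight l a m * (\<tau> ^ (h + n + k * customers l m) / fact (Suc h + k * customers l m))))"
  proof (rule sum.cong)
    fix m assume "m \<in> compositions l n"
    from weight[OF this, symmetric]
    show "\<eta> ^ n * ((\<Prod>i=1..l. c i ^ m i / fact (m i)) *
           (\<tau> ^ (Suc h + n + k * customers l m - 1) / fact (Suc h + k * customers l m)) *
           exp (- (1 + \<eta>) * \<tau>)) =
         exp (- (1 + \<eta>) * \<tau>) *
         (arrival_weight l a m * (\<tau> ^ (h + n + k * customers l m) / fact (Suc h + k * customers l m)))"
      by simp
  qed simp
  also have "\<dots> = exp (- (1 + \<eta>) * \<tau>) * (\<Sum>m\<in>compositions l n. arrival_weight l a m *
       (\<tau> ^ (h + n + k * customers l m) / fact (Suc h + k * customers l m)))"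
    by (rule sum_distrib_left[symmetric])
  finally show ?thesis .
qed

lemma erlang_summand_0:
  assumes "h \<ge> 1"
  shows "erlang_summand 0 k l \<eta> c \<tau> h n = \<tau> * erlang_summand 1 k l \<eta> c \<tau> h n"
proof -
  obtain g where "h = Suc g" using assms by (cases h) auto
  then show ?thesis
    by (simp add: erlang_summand_def sum_distrib_left mult_ac)
qed

text \<open>
  The Markov property at time \<open>0\<close> with no earlier observations; the conditioning event has
  probability one.
\<close>

lemma prob_empty_eq_transition:
  assumes Q: "markov_process M S P Q" "AE \<omega> in M. Q 0 \<omega> = (0, 0)" and S: "(0, 0) \<in> S" and t: "t \<ge> 0"
  shows "prob_empty M Q t = P t (0, 0) (0, 0)"
proof -
  interpret prob_space M using Q by (simp add: markov_process_def)
  have meas: "Q 0 \<in> measurable M (count_space UNIV)" using Q by (simp add: markov_process_def)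
  have "\<P>(\<omega> in M. Q 0 \<omega> = (0, 0)) = 1"
    using Q(2) meas by (intro prob_Collect_eq_1[THEN iffD2]) measurable
  moreover have "\<forall>t\<ge>0. \<forall>h\<ge>0. \<forall>T \<xi>. \<forall>x\<in>S. \<forall>y\<in>S. finite T \<longrightarrow> T \<subseteq> {0..t} \<longrightarrow>
      \<P>(\<omega> in M. (\<forall>s\<in>T. Q s \<omega> = \<xi> s) \<and> Q t \<omega> = x) > 0 \<longrightarrow>
      \<P>(\<omega> in M. Q (t + h) \<omega> = y \<bar> (\<forall>s\<in>T. Q s \<omega> = \<xi> s) \<and> Q t \<omega> = x) = P h x y"
    using Q(1) unfolding markov_process_def by blast
  note this[rule_format, of 0 t "(0, 0)" "(0, 0)" "{}"]
  ultimately show ?thesis using S t by (simp add: prob_empty_def)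
qed

theorem mainTheorem2:
  fixes k l :: nat and \<mu> \<Lambda> \<eta> \<tau> t :: real and lam c :: "nat \<Rightarrow> real"
    and M :: "'a measure" and Q :: "real \<Rightarrow> 'a \<Rightarrow> nat \<times> nat"
  assumes "k \<ge> 1" and "l \<ge> 1" and "\<mu> > 0"
    and "\<And>m. m \<in> {1..l} \<Longrightarrow> lam m > 0"
    and "\<Lambda> = (\<Sum>m=1..l. lam m)"
    and "\<And>m. m \<in> {1..l} \<Longrightarrow> c m = lam m / \<Lambda>"
    and "erlang_queue k l \<mu> lam M Q"
    and "\<eta> = \<Lambda> / (real k * \<mu>)"
    and "t \<ge> 0" and "\<tau> = real k * \<mu> * t"
  shows
    "(t > 0 \<longrightarrow>
        (\<forall>h\<ge>1. summable (erlang_summand 0 k l \<eta> c \<tau> h)) \<and>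
        summable (\<lambda>h. real (Suc h) * (\<Sum>n. erlang_summand 0 k l \<eta> c \<tau> (Suc h) n)) \<and>
        prob_empty M Q t =
          1 / \<tau> * (\<Sum>h. real (Suc h) * (\<Sum>n. erlang_summand 0 k l \<eta> c \<tau> (Suc h) n))) \<and>
     (t = 0 \<longrightarrow>
        (\<forall>h\<ge>1. summable (erlang_summand 1 k l \<eta> c \<tau> h)) \<and>
        summable (\<lambda>h. real (Suc h) * (\<Sum>n. erlang_summand 1 k l \<eta> c \<tau> (Suc h) n)) \<and>
        prob_empty M Q t = (\<Sum>h. real (Suc h) * (\<Sum>n. erlang_summand 1 k l \<eta> c \<tau> (Suc h) n)))"
proof -
  define \<kappa> where "\<kappa> = real k * \<mu>"
  define a where "a m = lam m / \<kappa>" for m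
  let ?S = "erlang_states k" and ?c1 = "erlang_summand 1 k l \<eta> c \<tau>"
  have \<kappa>: "\<kappa> > 0" using assms(1,3) by (simp add: \<kappa>_def)
  have \<tau>: "\<tau> = \<kappa> * t" "\<tau> \<ge> 0" using assms(9,10) \<kappa> by (simp_all add: \<kappa>_def)
  have \<eta>: "\<eta> = \<Lambda> / \<kappa>" by (simp add: assms(8) \<kappa>_def)
  have "lam 1 > 0" using assms(2,4) by simp
  then have \<Lambda>: "\<Lambda> > 0"
    unfolding assms(5) using assms(2,4) by (intro sum_pos) auto
  have a: "a m \<ge> 0" "a m = \<eta> * c m" if "m \<in> {1..l}" for m
    using assms(4,6)[OF that] \<Lambda> \<kappa> by (simp_all add: a_def \<eta>)
  have 0: "(0, 0) \<in> ?S" by (simp add: erlang_states_def)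
  from assms(7) obtain P where P: "markov_process M ?S P Q"
    "has_transition_rates ?S P (erlang_rate k l \<mu> lam)" "AE \<omega> in M. Q 0 \<omega> = (0, 0)"
    by (auto simp: erlang_queue_def markov_process_with_rates_def)
  then have trans: "transition_function ?S P" by (simp add: markov_process_def)
  have p0: "prob_empty M Q t = P t (0, 0) (0, 0)"
    by (rule prob_empty_eq_transition[OF P(1,3) 0 assms(9)])
  \<comment> \<open>The uniformisation rate \<open>\<kappa> + \<Lambda>\<close> in the time scale \<open>\<tau>\<close>.\<close>
  have exponent: "(\<kappa> + \<Lambda>) * t = (1 + \<eta>) * \<tau>"
    using \<kappa> by (simp add: \<tau>(1) \<eta> field_simps)
  have "(\<lambda>N. empty_coeff k l a N 0 * \<tau> ^ N) sums (exp ((1 + \<eta>) * \<tau>) * prob_empty M Q t)"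
    using erlang_empty_probability_series[OF assms(1) \<kappa>_def \<kappa> less_imp_le[OF assms(4)] trans P(2) 0 assms(9),
        folded assms(5), unfolded exponent]
    by (simp add: p0 a_def[abs_def] \<tau>(1) phases_def)
  note series = empty_series_by_passage_level[OF a(1) \<tau>(2) this]
  have summand: "real (Suc h) * ?c1 (Suc h) n = exp (- (1 + \<eta>) * \<tau>) *
      (\<Sum>m\<in>compositions l n. real (Suc h) * (arrival_weight l a m *
         (\<tau> ^ (h + n + k * customers l m) / fact (Suc h + k * customers l m))))" for h n
  proof -
    have "?c1 (Suc h) n = exp (- (1 + \<eta>) * \<tau>) * (\<Sum>m\<in>compositions l n. arrival_weight l a m *
       (\<tau> ^ (h + n + k * customers l m) / fact (Suc h + k * customers l m)))"
      by (rule erlang_summand_1) (rule a(2))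
    then show ?thesis
      by (simp only: sum_distrib_left[symmetric] mult.left_commute)
  qed
  have "summable (\<lambda>n. real (Suc h) * ?c1 (Suc h) n)" for h
    unfolding summand by (intro summable_mult series(1))
  then have summable_n: "summable (?c1 (Suc h))" for h
    using summable_mult_D[of "real (Suc h)" "?c1 (Suc h)"] by simp
  have level: "real (Suc h) * (\<Sum>n. ?c1 (Suc h) n) = exp (- (1 + \<eta>) * \<tau>) *
      (\<Sum>n. \<Sum>m\<in>compositions l n. real (Suc h) * (arrival_weight l a m *
         (\<tau> ^ (h + n + k * customers l m) / fact (Suc h + k * customers l m))))" for h
    unfolding suminf_mult[OF summable_n, symmetric] summand by (rule suminf_mult[OF series(1)])
  \<comment> \<open>With the factor \<open>1 / \<tau>\<close> absorbed, one identity covers all \<open>t \<ge> 0\<close>; the other form is \<open>\<tau>\<close> times it.\<close>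
  have exp_inv: "exp (- (1 + \<eta>) * \<tau>) * exp ((1 + \<eta>) * \<tau>) = 1"
    by (simp add: exp_add[symmetric] algebra_simps)
  have "(\<lambda>h. real (Suc h) * (\<Sum>n. ?c1 (Suc h) n)) sums
      (exp (- (1 + \<eta>) * \<tau>) * (exp ((1 + \<eta>) * \<tau>) * prob_empty M Q t))"
    unfolding level by (intro sums_mult series(2))
  then have sums: "(\<lambda>h. real (Suc h) * (\<Sum>n. ?c1 (Suc h) n)) sums prob_empty M Q t"
    using exp_inv by (simp only: mult.assoc[symmetric] mult_1)
  have summable_1: "summable (?c1 h)" if "h \<ge> 1" for h
    using summable_n[of "h - 1"] that by simp
  have "(\<Sum>n. erlang_summand 0 k l \<eta> c \<tau> (Suc h) n) = \<tau> * (\<Sum>n. ?c1 (Suc h) n)" for h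
    using suminf_mult[OF summable_n, of \<tau> h] by (simp add: erlang_summand_0)
  then have sums_0: "(\<lambda>h. real (Suc h) * (\<Sum>n. erlang_summand 0 k l \<eta> c \<tau> (Suc h) n))
      sums (\<tau> * prob_empty M Q t)"
    using sums_mult[OF sums, of \<tau>] by (simp only: mult.left_commute)
  have summable_0: "summable (erlang_summand 0 k l \<eta> c \<tau> h)" if "h \<ge> 1" for h
  proof -
    have "erlang_summand 0 k l \<eta> c \<tau> h = (\<lambda>n. \<tau> * ?c1 h n)"
      by (intro ext erlang_summand_0 that)
    then show ?thesis using summable_mult[OF summable_1[OF that]] by simp
  qed
  have "prob_empty M Q t =
      1 / \<tau> * (\<Sum>h. real (Suc h) * (\<Sum>n. erlang_summand 0 k l \<eta> c \<tau> (Suc h) n))" if "t > 0"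
    using sums_unique[OF sums_0, symmetric] that \<kappa> by (simp add: \<tau>(1))
  then show ?thesis
    using summable_0 summable_1 sums sums_0 by (auto simp: sums_iff)
qed

end
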